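(* Let $\xi_n$ be the number of type $B$ excedances of a type $B$ derangement chosen uniformly at random from $D_n^B$. Then the distribution of \[ \eta_n=\frac{\xi_n-\mathrm{E}\,\xi_n}{\sqrt{\mathrm{Var}\,\xi_n}} \] converges to the standard normal distribution as $n\to\infty$.
   Context: Let $B_n$ be the set of signed permutations $\sigma=\sigma_1\cdots\sigma_n$ of $[n]=\{1,\dots,n\}$ (permutations of $[n]$ in which some entries carry a minus sign). An index $i\in[n]$ is a type $B$ excedance of $\sigma$ if either $\sigma_i=-i$ or $\sigma_{|\sigma_i|}>\sigma_i$. A type $B$ derangement is $\sigma\in B_n$ with $\sigma_i\neq i$ for all $i\in[n]$ (entries $\sigma_i=-i$ are allowed); $D_n^B$ is the set of these. *)

theory Defs
  imports "HOL-Probability.Probability"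
begin

text \<open>
  A signed permutation of \<open>[n]\<close> is a word of nonzero integers whose absolute values form a
  permutation of \<open>[n]\<close>. The word is the function \<open>i \<mapsto> \<sigma>\<^sub>i\<close> on \<open>{1..n}\<close>, made unique as a
  total function by extensionality, so that different functions are different words.
\<close>

definition signed_perms :: "nat \<Rightarrow> (nat \<Rightarrow> int) set" where
  "signed_perms n =
     {\<sigma> \<in> extensional {1..n}. bij_betw (\<lambda>i. nat \<bar>\<sigma> i\<bar>) {1..n} {1..n}}"

definition excedancesB :: "nat \<Rightarrow> (nat \<Rightarrow> int) \<Rightarrow> nat set" where
  "excedancesB n \<sigma> = {i \<in> {1..n}. \<sigma> i = - int i \<or> \<sigma> (nat \<bar>\<sigma> i\<bar>) > \<sigma> i}"

definition excB :: "nat \<Rightarrow> (nat \<Rightarrow> int) \<Rightarrow> nat" where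
  "excB n \<sigma> = card (excedancesB n \<sigma>)"

definition derangementsB :: "nat \<Rightarrow> (nat \<Rightarrow> int) set" where
  "derangementsB n = {\<sigma> \<in> signed_perms n. \<forall>i\<in>{1..n}. \<sigma> i \<noteq> int i}"

text \<open>\<open>pmf_of_set\<close> is the uniform distribution only on a finite nonempty set.\<close>

lemma finite_derangementsB: "finite (derangementsB n)"
proof (rule finite_subset)
  show "derangementsB n \<subseteq> {1..n} \<rightarrow>\<^sub>E {- int n..int n}"
  proof
    fix \<sigma> assume "\<sigma> \<in> derangementsB n"
    then have ext: "\<sigma> \<in> extensional {1..n}"
      and bij: "bij_betw (\<lambda>i. nat \<bar>\<sigma> i\<bar>) {1..n} {1..n}"
      by (auto simp: derangementsB_def signed_perms_def)
    have "\<sigma> i \<in> {- int n..int n}" if "i \<in> {1..n}" for i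
      using bij_betwE[OF bij] that by fastforce
    with ext show "\<sigma> \<in> {1..n} \<rightarrow>\<^sub>E {- int n..int n}"
      by (auto simp: PiE_def)
  qed
  show "finite ({1..n} \<rightarrow>\<^sub>E {- int n..int n})"
    by (intro finite_PiE) auto
qed

lemma derangementsB_nonempty: "derangementsB n \<noteq> {}"
proof -
  have "bij_betw (\<lambda>i. nat \<bar>restrict (\<lambda>i. - int i) {1..n} i\<bar>) {1..n} {1..n}"
    by (subst bij_betw_cong[where g = id]) auto
  then have "restrict (\<lambda>i. - int i) {1..n} \<in> derangementsB n"
    by (auto simp: derangementsB_def signed_perms_def)
  then show ?thesis by blast
qed

definition rand_derangementB :: "nat \<Rightarrow> (nat \<Rightarrow> int) pmf" where
  "rand_derangementB n = pmf_of_set (derangementsB n)"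

definition \<xi> :: "nat \<Rightarrow> (nat \<Rightarrow> int) \<Rightarrow> real" where
  "\<xi> n \<sigma> = real (excB n \<sigma>)"

text \<open>
  For \<open>n \<le> 1\<close> the variance is \<open>0\<close> and division by zero makes \<open>\<eta> n\<close> constantly \<open>0\<close>;
  this does not affect the limit.
\<close>

definition \<eta> :: "nat \<Rightarrow> (nat \<Rightarrow> int) \<Rightarrow> real" where
  "\<eta> n \<sigma> =
     (\<xi> n \<sigma> - measure_pmf.expectation (rand_derangementB n) (\<xi> n)) /
     sqrt (measure_pmf.variance (rand_derangementB n) (\<xi> n))"

end

theory Submission
  imports Defs "HOL-Complex_Analysis.Complex_Analysis" "HOL-Real_Asymp.Real_Asymp"
begin

text \<open>
  In cycle notation, the type B excedances are the cyclic ascents of the signed entries, so inserting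
  \<open>\<plusminus>(n + 1)\<close> into a cycle creates a new excedance exactly if it is placed at a non-excedance. On all
  signed permutations this gives a recurrence for the characteristic function \<open>c\<^sub>n\<close> of the centred
  excedance number. Its solution is \<open>(-1) ^ n * sin z ^ (n + 1)\<close> times the \<open>n\<close>-th Taylor coefficient of
  \<open>1 / sin\<close> at \<open>z\<close>, and the pole of \<open>1 / sin\<close> at \<open>0\<close> yields \<open>c\<^sub>n z \<approx> (sin z / z) ^ (n + 1)\<close>.
  Inclusion-exclusion over the fixed points writes the law on derangements as a mixture, with weights
  proportional to \<open>(-1/2) ^ k / k!\<close>, of the laws on all signed permutations of size \<open>n - k\<close>. As the
  weights are absolutely summable, the mean, the variance and the characteristic function are
  evaluated asymptotically term by term, and Levy's continuity theorem applies.
\<close>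

section \<open>Insertion into signed permutations\<close>

lemma signed_perms_iff:
  "\<sigma> \<in> signed_perms n \<longleftrightarrow> \<sigma> \<in> extensional {1..n} \<and>
     (\<forall>i\<in>{1..n}. 1 \<le> \<bar>\<sigma> i\<bar> \<and> \<bar>\<sigma> i\<bar> \<le> int n) \<and> inj_on (\<lambda>i. \<bar>\<sigma> i\<bar>) {1..n}"
proof -
  have inj: "inj_on (\<lambda>i. nat \<bar>\<sigma> i\<bar>) {1..n} \<longleftrightarrow> inj_on (\<lambda>i. \<bar>\<sigma> i\<bar>) {1..n}"
    by (auto simp: inj_on_def)
  have "bij_betw (\<lambda>i. nat \<bar>\<sigma> i\<bar>) {1..n} {1..n} \<longleftrightarrow>
      inj_on (\<lambda>i. nat \<bar>\<sigma> i\<bar>) {1..n} \<and> (\<lambda>i. nat \<bar>\<sigma> i\<bar>) ` {1..n} \<subseteq> {1..n}"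
    unfolding bij_betw_def using endo_inj_surj[of "{1..n}" "\<lambda>i. nat \<bar>\<sigma> i\<bar>"] by blast
  then show ?thesis
    unfolding signed_perms_def mem_Collect_eq inj image_subset_iff
    by (auto simp: le_nat_iff nat_le_iff)
qed

lemma signed_perms_preimage:
  assumes "\<sigma> \<in> signed_perms n" "i \<in> {1..n}"
  obtains k where "k \<in> {1..n}" "\<bar>\<sigma> k\<bar> = int i"
proof -
  have "bij_betw (\<lambda>i. nat \<bar>\<sigma> i\<bar>) {1..n} {1..n}"
    using assms(1) by (simp add: signed_perms_def)
  then have "i \<in> (\<lambda>i. nat \<bar>\<sigma> i\<bar>) ` {1..n}"
    using assms(2) by (simp only: bij_betw_imp_surj_on)
  then obtain k where "k \<in> {1..n}" "i = nat \<bar>\<sigma> k\<bar>" by auto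
  then show thesis by (intro that[of k]) auto
qed

lemma finite_signed_perms: "finite (signed_perms n)"
proof (rule finite_subset)
  show "signed_perms n \<subseteq> {1..n} \<rightarrow>\<^sub>E {- int n..int n}"
    by (force simp: signed_perms_iff PiE_def Pi_def abs_le_iff)
  show "finite ({1..n} \<rightarrow>\<^sub>E {- int n..int n})"
    by (intro finite_PiE) auto
qed

lemma signed_perms_0: "signed_perms 0 = {\<lambda>_. undefined}"
  by (auto simp: signed_perms_iff)

text \<open>
  In cycle notation, \<open>s * (n + 1)\<close> is inserted just before the entry \<open>\<tau> i\<close>, or as a new
  cycle if \<open>i = n + 1\<close>.
\<close>

definition arc_insert :: "nat \<Rightarrow> (nat \<Rightarrow> int) \<Rightarrow> nat \<Rightarrow> int \<Rightarrow> nat \<Rightarrow> int" where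
  "arc_insert n \<tau> i s = (\<tau>(Suc n := \<tau> i))(i := s * int (Suc n))"

lemma arc_insert_in_signed_perms:
  assumes \<tau>: "\<tau> \<in> signed_perms n" and i: "i \<in> {1..Suc n}" and s: "s \<in> {1, -1}"
  shows "arc_insert n \<tau> i s \<in> signed_perms (Suc n)"
proof -
  define \<sigma> where "\<sigma> = arc_insert n \<tau> i s"
  have ext: "\<sigma> \<in> extensional {1..Suc n}"
    using \<tau> i by (auto simp: \<sigma>_def arc_insert_def signed_perms_iff extensional_def)
  have range: "1 \<le> \<bar>\<tau> j\<bar>" "\<bar>\<tau> j\<bar> \<le> int n" if "j \<in> {1..n}" for j
    using \<tau> that by (auto simp: signed_perms_iff)
  have abs_i: "\<bar>\<sigma> i\<bar> = int (Suc n)"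
    using s by (auto simp: \<sigma>_def arc_insert_def)
  have small: "1 \<le> \<bar>\<sigma> j\<bar> \<and> \<bar>\<sigma> j\<bar> \<le> int n" if "j \<in> {1..Suc n}" "j \<noteq> i" for j
    using range[of j] range[of i] that i by (auto simp: \<sigma>_def arc_insert_def le_Suc_eq)
  have inj_\<tau>: "inj_on (\<lambda>j. \<bar>\<tau> j\<bar>) {1..n}"
    using \<tau> by (simp add: signed_perms_iff)
  \<comment> \<open>Away from \<open>i\<close>, the new word reads off entries of \<tau>, with place
    \<open>n + 1\<close> holding the entry that left place \<open>i\<close>; injectivity is
    inherited through \<open>p\<close>.\<close>
  define p where "p = (\<lambda>a. if a = Suc n then i else a)"
  have \<sigma>_p: "\<sigma> a = \<tau> (p a)" "p a \<in> {1..n}" if "a \<in> {1..Suc n}" "a \<noteq> i" for a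
    using that i by (auto simp: \<sigma>_def arc_insert_def p_def)
  have old: "a = b" if ab: "\<bar>\<sigma> a\<bar> = \<bar>\<sigma> b\<bar>" "a \<in> {1..Suc n}" "b \<in> {1..Suc n}" "a \<noteq> i" "b \<noteq> i" for a b
  proof -
    have "p a = p b"
      by (rule inj_onD[OF inj_\<tau>]) (use ab \<sigma>_p in auto)
    then show ?thesis
      using ab by (auto simp: p_def split: if_splits)
  qed
  have "inj_on (\<lambda>j. \<bar>\<sigma> j\<bar>) {1..Suc n}"
  proof (rule inj_onI)
    fix a b assume ab: "a \<in> {1..Suc n}" "b \<in> {1..Suc n}" "\<bar>\<sigma> a\<bar> = \<bar>\<sigma> b\<bar>"
    then show "a = b"
      using small[of a] small[of b] abs_i old[of a b]
      by (cases "a = i"; cases "b = i") auto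
  qed
  moreover have "1 \<le> \<bar>\<sigma> j\<bar> \<and> \<bar>\<sigma> j\<bar> \<le> int (Suc n)" if "j \<in> {1..Suc n}" for j
    using small[of j] abs_i that by (cases "j = i") auto
  ultimately show ?thesis
    using ext unfolding \<sigma>_def[symmetric] signed_perms_iff by blast
qed

text \<open>The inverse looks for the entry of absolute value \<open>n + 1\<close>: its place is
  \<open>i\<close>, its sign is \<open>s\<close>, and cutting it out of its cycle leaves
  \<tau>.\<close>

lemma bij_betw_arc_insert:
  "bij_betw (\<lambda>(\<tau>, i, s). arc_insert n \<tau> i s)
     (signed_perms n \<times> {1..Suc n} \<times> {1, -1}) (signed_perms (Suc n))"
proof (rule bij_betw_imageI)
  show "inj_on (\<lambda>(\<tau>, i, s). arc_insert n \<tau> i s) (signed_perms n \<times> {1..Suc n} \<times> {1, -1})"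
  proof -
    have "\<tau> = \<tau>' \<and> i = i' \<and> s = s'"
      if \<tau>: "\<tau> \<in> signed_perms n" "\<tau>' \<in> signed_perms n"
      and i: "i \<in> {1..Suc n}" "i' \<in> {1..Suc n}" and s: "s \<in> {1, -1}" "s' \<in> {1, -1}"
      and eq: "arc_insert n \<tau> i s = arc_insert n \<tau>' i' s'"
    for \<tau> \<tau>' :: "nat \<Rightarrow> int" and i i' :: nat and s s' :: int
    proof -
    have pt: "arc_insert n \<tau> i s j = arc_insert n \<tau>' i' s' j" for j
      using eq by simp
    have inj: "inj_on (\<lambda>j. \<bar>arc_insert n \<tau> i s j\<bar>) {1..Suc n}"
      using arc_insert_in_signed_perms[OF \<tau>(1) i(1) s(1)] by (simp add: signed_perms_iff)
    have "\<bar>arc_insert n \<tau> i s i\<bar> = int (Suc n)" "\<bar>arc_insert n \<tau>' i' s' i'\<bar> = int (Suc n)"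
      using s by (auto simp: arc_insert_def)
    then have ii: "i = i'"
      using inj_onD[OF inj _ i] by (simp add: pt)
    have ss: "s = s'"
      using pt[of i] ii by (simp add: arc_insert_def del: of_nat_Suc)
    have "\<tau> j = \<tau>' j" for j
    proof (cases "j \<in> {1..n}")
      case True
      then show ?thesis
        using pt[of j] pt[of "Suc n"] ii by (auto simp: arc_insert_def split: if_splits)
    next
      case False
      then show ?thesis
        using \<tau> by (auto simp: signed_perms_iff extensional_def)
    qed
    then show ?thesis
      using ii ss by auto
    qed
    then show ?thesis
      by (intro inj_onI) (simp only: mem_Times_iff split_beta prod_eq_iff, blast)
  qed
  show "(\<lambda>(\<tau>, i, s). arc_insert n \<tau> i s) ` (signed_perms n \<times> {1..Suc n} \<times> {1, -1})
      = signed_perms (Suc n)"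
  proof (intro equalityI subsetI)
    fix \<sigma> assume \<sigma>: "\<sigma> \<in> signed_perms (Suc n)"
    obtain i where i: "i \<in> {1..Suc n}" "\<bar>\<sigma> i\<bar> = int (Suc n)"
      using signed_perms_preimage[OF \<sigma>, of "Suc n"] by auto
    \<comment> \<open>Place \<open>i\<close> takes over the entry at \<open>n + 1\<close>, which is
      thus bypassed. If \<open>i = n + 1\<close>, the update lies outside \<open>{1..n}\<close> and
      the restriction discards it.\<close>
    define \<tau> where "\<tau> = restrict (\<sigma>(i := \<sigma> (Suc n))) {1..n}"
    have inj: "a = b" if "\<bar>\<sigma> a\<bar> = \<bar>\<sigma> b\<bar>" "a \<in> {1..Suc n}" "b \<in> {1..Suc n}" for a b
      using \<sigma> that by (auto simp: signed_perms_iff inj_on_def)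
    have small: "1 \<le> \<bar>\<sigma> j\<bar> \<and> \<bar>\<sigma> j\<bar> \<le> int n" if "j \<in> {1..Suc n}" "j \<noteq> i" for j
    proof -
      have "1 \<le> \<bar>\<sigma> j\<bar> \<and> \<bar>\<sigma> j\<bar> \<le> int (Suc n)"
        using \<sigma> that by (auto simp: signed_perms_iff)
      moreover have "\<bar>\<sigma> j\<bar> \<noteq> int (Suc n)"
        using inj[of j i] i that by auto
      ultimately show ?thesis by auto
    qed
    have "\<tau> \<in> signed_perms n"
      unfolding signed_perms_iff
    proof (intro conjI ballI)
      fix j assume "j \<in> {1..n}"
      then show "1 \<le> \<bar>\<tau> j\<bar>" "\<bar>\<tau> j\<bar> \<le> int n"
        using small[of j] small[of "Suc n"] by (auto simp: \<tau>_def)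
    next
      show "inj_on (\<lambda>j. \<bar>\<tau> j\<bar>) {1..n}"
      proof (rule inj_onI)
        fix a b assume "a \<in> {1..n}" "b \<in> {1..n}" "\<bar>\<tau> a\<bar> = \<bar>\<tau> b\<bar>"
        then show "a = b"
          using inj[of a b] inj[of a "Suc n"] inj[of "Suc n" b]
          by (auto simp: \<tau>_def split: if_splits)
      qed
    qed (simp add: \<tau>_def)
    moreover have "\<sigma> = arc_insert n \<tau> i (sgn (\<sigma> i))"
    proof
      fix j
      have "\<sigma> i = sgn (\<sigma> i) * int (Suc n)"
        using i(2) by (metis sgn_mult_abs)
      moreover have "\<sigma> j = undefined" if "j \<notin> {1..Suc n}"
        using \<sigma> that by (auto simp: signed_perms_iff extensional_def)
      ultimately show "\<sigma> j = arc_insert n \<tau> i (sgn (\<sigma> i)) j"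
        using i(1) by (auto simp: arc_insert_def \<tau>_def simp del: of_nat_Suc)
    qed
    moreover have "sgn (\<sigma> i) \<in> {1, -1}"
      using i(2) by (auto simp: sgn_if)
    ultimately show "\<sigma> \<in> (\<lambda>(\<tau>, i, s). arc_insert n \<tau> i s) ` (signed_perms n \<times> {1..Suc n} \<times> {1, -1})"
      using i(1) by (force intro!: image_eqI[of _ _ "(\<tau>, i, sgn (\<sigma> i))"])
  qed (auto intro!: arc_insert_in_signed_perms)
qed

section \<open>Excedances and fixed points under insertion\<close>

definition fixB :: "nat \<Rightarrow> (nat \<Rightarrow> int) \<Rightarrow> nat" where
  "fixB n \<sigma> = card {i \<in> {1..n}. \<sigma> i = int i}"

text \<open>The new entry splits the step from \<open>\<tau> k\<close> to its successor in two, and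
  being extreme it makes exactly one of them an ascent: the first if \<open>s = 1\<close>, the
  second if \<open>s = -1\<close>. The old status of \<open>k\<close> is lost, and all others
  survive, that of \<open>i\<close> at place \<open>n + 1\<close>.\<close>

lemma excB_arc_insert:
  assumes \<tau>: "\<tau> \<in> signed_perms n" and k: "k \<in> {1..n}" and s: "s \<in> {1, -1}"
  shows "excB (Suc n) (arc_insert n \<tau> (nat \<bar>\<tau> k\<bar>) s) =
           excB n \<tau> + (if k \<in> excedancesB n \<tau> then 0 else 1)"
proof -
  define i where "i = nat \<bar>\<tau> k\<bar>"
  define \<sigma> where "\<sigma> = arc_insert n \<tau> i s"
  let ?E = "excedancesB n \<tau>"
  have range: "1 \<le> \<bar>\<tau> j\<bar>" "\<bar>\<tau> j\<bar> \<le> int n" if "j \<in> {1..n}" for j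
    using \<tau> that by (auto simp: signed_perms_iff)
  have i: "i \<in> {1..n}" "int i = \<bar>\<tau> k\<bar>"
    using range[OF k] by (auto simp: i_def)
  have fin: "finite ?E" by (simp add: excedancesB_def)
  have sub: "?E \<subseteq> {1..n}" by (auto simp: excedancesB_def)
  have preim: "j = k" if "j \<in> {1..n}" "nat \<bar>\<tau> j\<bar> = i" for j
  proof -
    have "inj_on (\<lambda>j. \<bar>\<tau> j\<bar>) {1..n}" using \<tau> by (simp add: signed_perms_iff)
    moreover have "\<bar>\<tau> j\<bar> = \<bar>\<tau> k\<bar>" using that(2) by (auto simp: i_def)
    ultimately show ?thesis using that(1) k by (rule inj_onD)
  qed
  have nN: "nat \<bar>\<tau> j\<bar> \<noteq> Suc n" if "j \<in> {1..n}" for j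
    using range[OF that] by auto
  have \<sigma>_simps: "\<sigma> i = s * int (Suc n)" "\<sigma> (Suc n) = \<tau> i"
    "\<And>j. j \<noteq> i \<Longrightarrow> j \<noteq> Suc n \<Longrightarrow> \<sigma> j = \<tau> j"
    using i by (auto simp: \<sigma>_def arc_insert_def)
  have mem: "j \<in> excedancesB (Suc n) \<sigma> \<longleftrightarrow>
      (j \<in> {1..n} \<and> j \<noteq> i \<and> j \<noteq> k \<and> j \<in> ?E) \<or>
      (j = i \<and> s = -1) \<or> (j = k \<and> k \<noteq> i \<and> s = 1) \<or>
      (j = Suc n \<and> (if k = i then s = 1 else i \<in> ?E))" for j
  proof -
    consider "j \<notin> {1..Suc n}" | "j = Suc n" | "j = i" | "j = k" "k \<noteq> i" | "j \<in> {1..n}" "j \<noteq> i" "j \<noteq> k"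
      by force
    then show ?thesis
    proof cases
      case 1
      then show ?thesis using i k by (auto simp: excedancesB_def)
    next
      case 2
      show ?thesis
      proof (cases "k = i")
        case True
        then have "nat \<bar>\<tau> i\<bar> = i" using i_def by simp
        then show ?thesis
          using 2 True s i range[OF i(1)] by (auto simp: excedancesB_def \<sigma>_simps)
      next
        case False
        then have ne: "nat \<bar>\<tau> i\<bar> \<noteq> i" using preim[OF i(1)] by auto
        then have "\<tau> i \<noteq> - int i" by auto
        then show ?thesis
          using 2 False i k nN[OF i(1)] ne range[OF i(1)]
          by (auto simp: excedancesB_def \<sigma>_simps)
      qed
    next
      case 3
      then show ?thesis
        using s i k range[OF i(1)] by (auto simp: excedancesB_def \<sigma>_simps nat_add_distrib)
    next
      case 4
      then have "\<tau> k \<noteq> - int k" using i(2) by auto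
      with 4 show ?thesis
        using s i(1) k range[OF k]
        by (auto simp: excedancesB_def \<sigma>_simps i_def[symmetric])
    next
      case 5
      then have "nat \<bar>\<tau> j\<bar> \<noteq> i" using preim by auto
      then show ?thesis
        using 5 nN[of j] by (auto simp: excedancesB_def \<sigma>_simps)
    qed
  qed
  have rest: "card ?E = card (?E - {i, k}) + (if k \<in> ?E then 1 else 0) + (if i \<in> ?E \<and> i \<noteq> k then 1 else 0)"
  proof -
    have "card ((?E - {i, k}) \<union> (?E \<inter> {i, k})) = card (?E - {i, k}) + card (?E \<inter> {i, k})"
      using fin by (intro card_Un_disjoint) auto
    then have "card ?E = card (?E - {i, k}) + card (?E \<inter> {i, k})"
      by (simp only: Un_Diff_Int)
    moreover have "card (?E \<inter> {i, k}) = (if k \<in> ?E then 1 else 0) + (if i \<in> ?E \<and> i \<noteq> k then 1 else 0)"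
      by (cases "i = k"; cases "i \<in> ?E"; cases "k \<in> ?E") auto
    ultimately show ?thesis by simp
  qed
  have notin: "Suc n \<notin> ?E" using sub by auto
  have "card (excedancesB (Suc n) \<sigma>) = card (?E - {i, k}) + 1 + (if i \<in> ?E \<and> i \<noteq> k then 1 else 0)"
  proof (cases "k = i")
    case True
    \<comment> \<open>For a one-cycle the step into the new entry starts at place
      \<open>n + 1\<close>, so for \<open>s = 1\<close> the new excedance sits there and not at
      \<open>k\<close>.\<close>
    have "excedancesB (Suc n) \<sigma> = (?E - {i, k}) \<union> {if s = 1 then Suc n else i}"
      using mem True s sub by (auto split: if_splits)
    then show ?thesis
      using fin notin True by (simp add: card_insert_if)
  next
    case False
    have "excedancesB (Suc n) \<sigma> =
        insert (if s = 1 then k else i) ((?E - {i, k}) \<union> (if i \<in> ?E then {Suc n} else {}))"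
      using mem False s sub by (auto split: if_splits)
    then show ?thesis
      using fin notin False i k by (auto simp: card_insert_if)
  qed
  then show ?thesis
    using rest unfolding excB_def i_def[symmetric] \<sigma>_def[symmetric] by auto
qed

text \<open>A new one-cycle has no neighbour to compare with; by the convention for
  \<open>\<sigma> i = - int i\<close> it counts exactly when its sign is negative.\<close>

lemma excB_arc_insert_new:
  assumes \<tau>: "\<tau> \<in> signed_perms n" and s: "s \<in> {1, -1}"
  shows "excB (Suc n) (arc_insert n \<tau> (Suc n) s) = excB n \<tau> + (if s = 1 then 0 else 1)"
proof -
  have range: "1 \<le> \<bar>\<tau> j\<bar>" "\<bar>\<tau> j\<bar> \<le> int n" if "j \<in> {1..n}" for j
    using \<tau> that by (auto simp: signed_perms_iff)
  have nN: "nat \<bar>\<tau> j\<bar> \<noteq> Suc n" if "j \<in> {1..n}" for j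
    using range[OF that] by auto
  have "excedancesB (Suc n) (arc_insert n \<tau> (Suc n) s) =
      excedancesB n \<tau> \<union> (if s = 1 then {} else {Suc n})"
    using s nN by (auto simp: excedancesB_def arc_insert_def le_Suc_eq nat_add_distrib)
  then show ?thesis
    by (auto simp: excB_def excedancesB_def card_insert_if)
qed

text \<open>The enlarged cycle contains no fixed point, so the only loss is \<open>k\<close> itself,
  if it was a one-cycle of positive sign.\<close>

lemma fixB_arc_insert:
  assumes \<tau>: "\<tau> \<in> signed_perms n" and k: "k \<in> {1..n}" and s: "s \<in> {1, -1}"
  shows "fixB (Suc n) (arc_insert n \<tau> (nat \<bar>\<tau> k\<bar>) s) =
           fixB n \<tau> - (if \<tau> k = int k then 1 else 0)"
proof -
  define i where "i = nat \<bar>\<tau> k\<bar>"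
  have range: "1 \<le> \<bar>\<tau> j\<bar>" "\<bar>\<tau> j\<bar> \<le> int n" if "j \<in> {1..n}" for j
    using \<tau> that by (auto simp: signed_perms_iff)
  have i: "i \<in> {1..n}" "int i = \<bar>\<tau> k\<bar>"
    using range[OF k] by (auto simp: i_def)
  have fixed: "\<tau> k = int k \<longleftrightarrow> \<tau> i = int i"
  proof
    assume "\<tau> i = int i"
    then have "\<bar>\<tau> i\<bar> = \<bar>\<tau> k\<bar>" using i by simp
    moreover have "inj_on (\<lambda>j. \<bar>\<tau> j\<bar>) {1..n}"
      using \<tau> by (simp add: signed_perms_iff)
    ultimately have "i = k" using i(1) k by (metis inj_onD)
    with \<open>\<tau> i = int i\<close> show "\<tau> k = int k" by simp
  qed (simp add: i_def)
  have "{j \<in> {1..Suc n}. arc_insert n \<tau> i s j = int j} = {j \<in> {1..n}. \<tau> j = int j} - {i}"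
    using i s range[OF i(1)] by (auto simp: arc_insert_def le_Suc_eq split: if_splits)
  then show ?thesis
    unfolding fixB_def i_def[symmetric] fixed using i by (auto simp: card_Diff_singleton_if)
qed

lemma fixB_arc_insert_new:
  assumes \<tau>: "\<tau> \<in> signed_perms n" and s: "s \<in> {1, -1}"
  shows "fixB (Suc n) (arc_insert n \<tau> (Suc n) s) = fixB n \<tau> + (if s = 1 then 1 else 0)"
proof -
  have "{j \<in> {1..Suc n}. arc_insert n \<tau> (Suc n) s j = int j} =
      {j \<in> {1..n}. \<tau> j = int j} \<union> (if s = 1 then {Suc n} else {})"
    using s by (auto simp: arc_insert_def le_Suc_eq split: if_splits)
  then show ?thesis
    unfolding fixB_def by (auto simp: card_insert_if)
qed

section \<open>Averages over signed permutations and over derangements\<close>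

text \<open>Insertion places are indexed by the preceding entry \<open>\<tau> k\<close>: at an
  excedance both counts stay, at a fixed point one excedance is gained and the fixed point lost,
  elsewhere one excedance is gained. Each happens for both signs; a new cycle adds one fixed point
  or one excedance.\<close>

lemma sum_arc_insert:
  fixes \<Phi> :: "nat \<Rightarrow> nat \<Rightarrow> 'a::comm_ring_1"
  assumes \<tau>: "\<tau> \<in> signed_perms n"
  defines "Y \<equiv> excB n \<tau>" and "f \<equiv> fixB n \<tau>"
  shows "(\<Sum>i\<in>{1..Suc n}. \<Sum>s\<in>{1, -1}.
            \<Phi> (excB (Suc n) (arc_insert n \<tau> i s)) (fixB (Suc n) (arc_insert n \<tau> i s))) =
         \<Phi> Y (f + 1) + \<Phi> (Y + 1) f + 2 * of_nat Y * \<Phi> Y f + 2 * of_nat f * \<Phi> (Y + 1) (f - 1)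
           + 2 * (of_nat n - of_nat Y - of_nat f) * \<Phi> (Y + 1) f"
proof -
  define E F where "E = excedancesB n \<tau>" and "F = {i \<in> {1..n}. \<tau> i = int i}"
  define h where "h i = (\<Sum>s\<in>{1, -1}. \<Phi> (excB (Suc n) (arc_insert n \<tau> i s)) (fixB (Suc n) (arc_insert n \<tau> i s)))" for i
  have bij: "bij_betw (\<lambda>k. nat \<bar>\<tau> k\<bar>) {1..n} {1..n}"
    using \<tau> by (simp add: signed_perms_def)
  have h: "h (nat \<bar>\<tau> k\<bar>) = 2 * \<Phi> (Y + 1) f + (if k \<in> E then 2 * (\<Phi> Y f - \<Phi> (Y + 1) f) else 0)
      + (if k \<in> F then 2 * (\<Phi> (Y + 1) (f - 1) - \<Phi> (Y + 1) f) else 0)" if k: "k \<in> {1..n}" for k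
  proof -
    have "\<not> (k \<in> E \<and> k \<in> F)" using k by (auto simp: E_def F_def excedancesB_def)
    then show ?thesis
      using k by (auto simp: E_def F_def h_def excB_arc_insert[OF \<tau> k] fixB_arc_insert[OF \<tau> k] Y_def f_def algebra_simps)
  qed
  have "(\<Sum>i\<in>{1..Suc n}. h i) = h (Suc n) + (\<Sum>i\<in>{1..n}. h i)"
    by (simp add: add.commute)
  also have "h (Suc n) = \<Phi> Y (f + 1) + \<Phi> (Y + 1) f"
    by (simp add: h_def excB_arc_insert_new[OF \<tau>] fixB_arc_insert_new[OF \<tau>] Y_def f_def)
  also have "(\<Sum>i\<in>{1..n}. h i) = (\<Sum>k\<in>{1..n}. h (nat \<bar>\<tau> k\<bar>))"
    by (rule sum.reindex_bij_betw[OF bij, symmetric])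
  also have "\<dots> = of_nat n * (2 * \<Phi> (Y + 1) f) + of_nat (card ({1..n} \<inter> E)) * (2 * (\<Phi> Y f - \<Phi> (Y + 1) f))
      + of_nat (card ({1..n} \<inter> F)) * (2 * (\<Phi> (Y + 1) (f - 1) - \<Phi> (Y + 1) f))"
    by (simp add: h sum.distrib sum.If_cases)
  also have "{1..n} \<inter> E = E" by (auto simp: E_def excedancesB_def)
  also have "{1..n} \<inter> F = F" by (auto simp: F_def)
  finally show ?thesis
    unfolding h_def E_def F_def excB_def[symmetric] fixB_def[symmetric] Y_def[symmetric] f_def[symmetric]
    by (simp add: algebra_simps)
qed

lemma sum_signed_perms_Suc:
  fixes \<Phi> :: "nat \<Rightarrow> nat \<Rightarrow> 'a::comm_ring_1"
  shows "(\<Sum>\<sigma>\<in>signed_perms (Suc n). \<Phi> (excB (Suc n) \<sigma>) (fixB (Suc n) \<sigma>)) =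
    (\<Sum>\<tau>\<in>signed_perms n. let Y = excB n \<tau>; f = fixB n \<tau> in
       \<Phi> Y (f + 1) + \<Phi> (Y + 1) f + 2 * of_nat Y * \<Phi> Y f + 2 * of_nat f * \<Phi> (Y + 1) (f - 1)
         + 2 * (of_nat n - of_nat Y - of_nat f) * \<Phi> (Y + 1) f)"
proof -
  have "(\<Sum>\<sigma>\<in>signed_perms (Suc n). \<Phi> (excB (Suc n) \<sigma>) (fixB (Suc n) \<sigma>)) =
      (\<Sum>(\<tau>, i, s)\<in>signed_perms n \<times> {1..Suc n} \<times> {1, -1}.
         \<Phi> (excB (Suc n) (arc_insert n \<tau> i s)) (fixB (Suc n) (arc_insert n \<tau> i s)))"
    by (subst sum.reindex_bij_betw[OF bij_betw_arc_insert, symmetric]) (simp add: split_beta)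
  also have "\<dots> = (\<Sum>\<tau>\<in>signed_perms n. \<Sum>i\<in>{1..Suc n}. \<Sum>s\<in>{1, -1}.
         \<Phi> (excB (Suc n) (arc_insert n \<tau> i s)) (fixB (Suc n) (arc_insert n \<tau> i s)))"
    by (simp only: sum.cartesian_product)
  finally show ?thesis
    by (simp only: sum_arc_insert Let_def cong: sum.cong)
qed

section \<open>Sums by excedance number, and inclusion-exclusion over fixed points\<close>

definition sumB :: "nat \<Rightarrow> (nat \<Rightarrow> 'a::comm_ring_1) \<Rightarrow> 'a" where
  "sumB n g = (\<Sum>\<sigma>\<in>signed_perms n. g (excB n \<sigma>))"

lemma sumB_0: "sumB 0 g = g 0"
  by (simp add: sumB_def signed_perms_0 excB_def excedancesB_def)

lemma sumB_Suc:
  "sumB (Suc n) g = sumB n (\<lambda>y. (2 * of_nat y + 1) * g y + (2 * of_nat n - 2 * of_nat y + 1) * g (Suc y))"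
  unfolding sumB_def
  by (subst sum_signed_perms_Suc[where \<Phi> = "\<lambda>y f. g y"]) (simp add: Let_def algebra_simps)

lemma sumB_add: "sumB n (\<lambda>y. g y + h y) = sumB n g + sumB n h"
  by (simp add: sumB_def sum.distrib)

lemma sumB_cmult: "sumB n (\<lambda>y. c * g y) = c * sumB n g"
  by (simp add: sumB_def sum_distrib_left)

lemma fixB_le: "fixB n \<sigma> \<le> n"
  unfolding fixB_def by (rule order.trans[OF card_mono[of "{1..n}"]]) auto

text \<open>
  Deleting \<open>k\<close> chosen fixed points and relabelling the rest would give a bijective proof; the
  insertion recurrence avoids the relabelling.
\<close>

lemma sum_binomial_fixB:
  fixes g :: "nat \<Rightarrow> 'a::comm_ring_1"
  shows "(\<Sum>\<sigma>\<in>signed_perms n. of_nat (fixB n \<sigma> choose k) * g (excB n \<sigma>)) =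
    of_nat (n choose k) * sumB (n - k) g"
proof (induction n arbitrary: k g)
  case 0
  then show ?case by (simp add: sumB_def signed_perms_0 fixB_def)
next
  case (Suc n)
  show ?case
  proof (cases k)
    case 0
    then show ?thesis by (simp add: sumB_def)
  next
    case k: (Suc k')
    \<comment> \<open>These are the coefficients of \<open>sumB_Suc\<close> at size
      \<open>n - k\<close>, with the subtraction taken in the ring, so that \<open>k > n\<close> is
      allowed here.\<close>
    define U where "U = (\<lambda>y. (2 * of_nat y + 1) * g y + (2 * (of_nat n - of_nat k) - 2 * of_nat y + 1) * g (Suc y))"
    have absorb: "of_nat f * of_nat ((f - 1) choose k) = (of_nat f - of_nat k) * (of_nat (f choose k) :: 'a)" for f
    proof (cases "k \<le> f")
      case True
      then have "(of_nat f - of_nat k) * (of_nat (f choose k) :: 'a) = of_nat ((f - k) * (f choose k))"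
        by simp
      then show ?thesis
        by (simp only: binomial_absorb_comp of_nat_mult)
    next
      case False
      then show ?thesis by (simp add: binomial_eq_0)
    qed
    \<comment> \<open>Pascal's rule splits off the \<open>k'\<close> term, and \<open>absorb\<close>
      replaces \<open>f * ((f - 1) choose k)\<close> by \<open>(f - k) * (f choose k)\<close>. After
      that \<open>f\<close> cancels from the factor beside \<open>f choose k\<close>.\<close>
    have step: "of_nat ((f + 1) choose k) * g Y + of_nat (f choose k) * g (Y + 1)
          + 2 * of_nat Y * (of_nat (f choose k) * g Y) + 2 * of_nat f * (of_nat ((f - 1) choose k) * g (Y + 1))
          + 2 * (of_nat n - of_nat Y - of_nat f) * (of_nat (f choose k) * g (Y + 1))
        = of_nat (f choose k') * g Y + of_nat (f choose k) * U Y" for f Y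
    proof -
      have "2 * of_nat f * (of_nat ((f - 1) choose k) * g (Y + 1)) = 2 * ((of_nat f - of_nat k) * of_nat (f choose k)) * g (Y + 1)"
        by (simp only: absorb[symmetric] mult.assoc)
      then show ?thesis
        unfolding U_def by (simp add: k algebra_simps)
    qed
    have "(\<Sum>\<sigma>\<in>signed_perms (Suc n). of_nat (fixB (Suc n) \<sigma> choose k) * g (excB (Suc n) \<sigma>)) =
        (\<Sum>\<tau>\<in>signed_perms n. of_nat (fixB n \<tau> choose k') * g (excB n \<tau>)) +
        (\<Sum>\<tau>\<in>signed_perms n. of_nat (fixB n \<tau> choose k) * U (excB n \<tau>))"
      by (subst sum_signed_perms_Suc[where \<Phi> = "\<lambda>y f. of_nat (f choose k) * g y"])
        (simp only: Let_def step sum.distrib)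
    also have "\<dots> = of_nat (n choose k') * sumB (n - k') g + of_nat (n choose k) * sumB (n - k) U"
      by (simp only: Suc.IH)
    also have "of_nat (n choose k) * sumB (n - k) U = of_nat (n choose k) * sumB (n - k') g"
    proof (cases "k \<le> n")
      case True
      then have "n - k' = Suc (n - k)" "U = (\<lambda>y. (2 * of_nat y + 1) * g y + (2 * of_nat (n - k) - 2 * of_nat y + 1) * g (Suc y))"
        using k by (auto simp: U_def)
      then show ?thesis by (simp only: sumB_Suc)
    next
      case False
      then show ?thesis by (simp add: binomial_eq_0)
    qed
    finally show ?thesis by (simp add: k algebra_simps)
  qed
qed

text \<open>Inclusion-exclusion: the alternating sum over \<open>k\<close> of
  \<open>fixB n \<sigma> choose k\<close> is 1 if there is no fixed point and 0 otherwise.\<close>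

lemma sum_derangementsB:
  fixes g :: "nat \<Rightarrow> 'a::comm_ring_1"
  shows "(\<Sum>\<sigma>\<in>derangementsB n. g (excB n \<sigma>)) =
    (\<Sum>k\<le>n. (-1) ^ k * of_nat (n choose k) * sumB (n - k) g)"
proof -
  have alt: "(\<Sum>k\<le>n. (-1) ^ k * of_nat (f choose k)) = (if f = 0 then 1 else 0 :: 'a)" if "f \<le> n" for f
  proof -
    have "(\<Sum>k\<le>n. (-1) ^ k * of_nat (f choose k)) = (\<Sum>k\<le>f. (-1) ^ k * of_nat (f choose k) :: 'a)"
      using that by (intro sum.mono_neutral_right) (auto simp: binomial_eq_0)
    then show ?thesis
      using choose_alternating_sum[of f, where 'a = 'a] by auto
  qed
  have fix0: "\<sigma> \<in> derangementsB n \<longleftrightarrow> \<sigma> \<in> signed_perms n \<and> fixB n \<sigma> = 0" for \<sigma>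
    by (auto simp: derangementsB_def fixB_def)
  have "(\<Sum>\<sigma>\<in>derangementsB n. g (excB n \<sigma>)) =
      (\<Sum>\<sigma>\<in>signed_perms n. (if fixB n \<sigma> = 0 then 1 else 0) * g (excB n \<sigma>))"
    by (intro sum.mono_neutral_cong_left finite_signed_perms) (auto simp: fix0)
  also have "\<dots> = (\<Sum>\<sigma>\<in>signed_perms n. \<Sum>k\<le>n. (-1) ^ k * (of_nat (fixB n \<sigma> choose k) * g (excB n \<sigma>)))"
    by (simp only: alt[OF fixB_le, symmetric] sum_distrib_right mult.assoc)
  also have "\<dots> = (\<Sum>k\<le>n. (-1) ^ k * (\<Sum>\<sigma>\<in>signed_perms n. of_nat (fixB n \<sigma> choose k) * g (excB n \<sigma>)))"
    by (subst sum.swap) (simp only: sum_distrib_left)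
  finally show ?thesis
    by (simp only: sum_binomial_fixB mult.assoc)
qed

text \<open>The denominator is the number of signed permutations; \<open>card_signed_perms\<close>
  extracts this from \<open>avgB_1\<close>.\<close>

definition avgB :: "nat \<Rightarrow> (nat \<Rightarrow> 'a::real_normed_field) \<Rightarrow> 'a" where
  "avgB n g = sumB n g / (2 ^ n * fact n)"

lemma avgB_0: "avgB 0 g = g 0"
  by (simp add: avgB_def sumB_0)

lemma avgB_add: "avgB n (\<lambda>y. g y + h y) = avgB n g + avgB n h"
  by (simp add: avgB_def sumB_add add_divide_distrib)

lemma avgB_cmult: "avgB n (\<lambda>y. c * g y) = c * avgB n g"
  by (simp add: avgB_def sumB_cmult)

text \<open>One random insertion: the coefficients are the probabilities that an excedance number
  \<open>y\<close> stays or grows by one.\<close>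

lemma avgB_Suc:
  fixes g :: "nat \<Rightarrow> 'a::real_normed_field"
  shows "avgB (Suc n) g = avgB n (\<lambda>y.
     (1 / 2 + (of_nat y - of_nat n / 2) / of_nat (Suc n)) * g y +
     (1 / 2 - (of_nat y - of_nat n / 2) / of_nat (Suc n)) * g (Suc y))"
proof -
  have nz: "(of_nat (Suc n) :: 'a) \<noteq> 0" by (rule of_nat_neq_0)
  define d where "d = (of_nat (Suc n) :: 'a)"
  have d: "d \<noteq> 0" "of_nat n = d - 1" using nz by (simp_all add: d_def)
  have "avgB n (\<lambda>y.
     (1 / 2 + (of_nat y - of_nat n / 2) / of_nat (Suc n)) * g y +
     (1 / 2 - (of_nat y - of_nat n / 2) / of_nat (Suc n)) * g (Suc y)) =
    avgB n (\<lambda>y. (1 / (2 * d)) * ((2 * of_nat y + 1) * g y + (2 * of_nat n - 2 * of_nat y + 1) * g (Suc y)))"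
    unfolding d_def[symmetric]
  proof (intro arg_cong[where f = "avgB n"] ext)
    fix y
    have eqs: "1 / 2 + (of_nat y - of_nat n / 2) / d = (1 / (2 * d)) * (2 * of_nat y + 1)"
      "1 / 2 - (of_nat y - of_nat n / 2) / d = (1 / (2 * d)) * (2 * of_nat n - 2 * of_nat y + 1)"
      unfolding d(2) using d(1) by (simp_all add: field_simps)
    show "(1 / 2 + (of_nat y - of_nat n / 2) / d) * g y + (1 / 2 - (of_nat y - of_nat n / 2) / d) * g (Suc y) =
        (1 / (2 * d)) * ((2 * of_nat y + 1) * g y + (2 * of_nat n - 2 * of_nat y + 1) * g (Suc y))"
      unfolding eqs by (metis distrib_left mult.assoc)
  qed
  also have "\<dots> = avgB (Suc n) g"
    unfolding avgB_cmult by (simp add: avgB_def sumB_Suc d_def field_simps)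
  finally show ?thesis ..
qed

lemma avgB_1: "avgB n (\<lambda>_. 1 :: 'a::real_normed_field) = 1"
proof (induction n)
  case (Suc n)
  have "avgB (Suc n) (\<lambda>_. 1 :: 'a) = avgB n (\<lambda>_. 1)"
    unfolding avgB_Suc by (intro arg_cong[where f = "avgB n"] ext) (simp add: field_simps)
  with Suc show ?case by simp
qed (simp add: avgB_0)

lemma avgB_const: "avgB n (\<lambda>_. c) = c"
  using avgB_cmult[of n c "\<lambda>_. 1"] by (simp add: avgB_1)

lemma card_signed_perms: "real (card (signed_perms n)) = 2 ^ n * fact n"
  using avgB_1[of n, where 'a = real] by (simp add: avgB_def sumB_def)

lemma norm_avgB_le:
  fixes g :: "nat \<Rightarrow> 'a::real_normed_field"
  assumes "\<And>y. norm (g y) \<le> c"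
  shows "norm (avgB n g) \<le> c"
proof -
  have "norm (sumB n g) \<le> real (card (signed_perms n)) * c"
    unfolding sumB_def by (rule sum_norm_bound) (rule assms)
  then show ?thesis
    by (simp add: avgB_def norm_divide norm_mult norm_power card_signed_perms field_simps)
qed

section \<open>Uniform derangements as a signed mixture\<close>

definition inv_exp_coeff :: "nat \<Rightarrow> real" where
  "inv_exp_coeff k = (- 1) ^ k / (2 ^ k * fact k)"

definition inv_exp_sum :: "nat \<Rightarrow> real" where
  "inv_exp_sum n = (\<Sum>k\<le>n. inv_exp_coeff k)"

text \<open>Up to sign, the weight is \<open>n choose k\<close> times the ratio of the numbers of
  signed permutations of sizes \<open>n - k\<close> and \<open>n\<close>, that is
  \<open>1 / (2 ^ k * k!)\<close>.\<close>

lemma sum_derangementsB_avgB: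
  fixes g :: "nat \<Rightarrow> 'a::real_normed_field"
  shows "(\<Sum>\<sigma>\<in>derangementsB n. g (excB n \<sigma>)) =
    2 ^ n * fact n * (\<Sum>k\<le>n. of_real (inv_exp_coeff k) * avgB (n - k) g)"
proof -
  have "(-1) ^ k * of_nat (n choose k) * sumB (n - k) g =
      2 ^ n * fact n * (of_real (inv_exp_coeff k) * avgB (n - k) g)" if "k \<le> n" for k
  proof -
    have "(2 :: 'a) ^ n = 2 ^ k * 2 ^ (n - k)"
      using that by (simp flip: power_add)
    then show ?thesis
      using that
      by (simp add: binomial_fact avgB_def inv_exp_coeff_def field_simps)
  qed
  then show ?thesis
    unfolding sum_derangementsB by (simp add: sum_distrib_left)
qed

lemma card_derangementsB: "real (card (derangementsB n)) = 2 ^ n * fact n * inv_exp_sum n"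
  using sum_derangementsB_avgB[of "\<lambda>_. 1 :: real" n] by (simp add: avgB_1 inv_exp_sum_def)

lemma expectation_rand_derangementB:
  fixes g :: "nat \<Rightarrow> 'a::{real_normed_field, banach, second_countable_topology}"
  shows "measure_pmf.expectation (rand_derangementB n) (\<lambda>\<sigma>. g (excB n \<sigma>)) =
    (\<Sum>k\<le>n. of_real (inv_exp_coeff k) * avgB (n - k) g) / of_real (inv_exp_sum n)"
proof -
  have "measure_pmf.expectation (rand_derangementB n) (\<lambda>\<sigma>. g (excB n \<sigma>)) =
      (\<Sum>\<sigma>\<in>derangementsB n. g (excB n \<sigma>)) / of_real (real (card (derangementsB n)))"
    unfolding rand_derangementB_def
    using finite_derangementsB[of n] derangementsB_nonempty[of n]
    by (subst integral_measure_pmf[of "derangementsB n"])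
      (auto simp: sum_divide_distrib scaleR_conv_of_real divide_simps)
  then show ?thesis
    unfolding card_derangementsB sum_derangementsB_avgB by simp
qed

section \<open>The cosecant recurrence\<close>

text \<open>The pole lemma is applied twice: \<open>S\<close> extends \<open>sin z / z\<close>, and
  for \<open>T = 1 / S\<close> the difference quotient at 0 is
  \<open>(z / sin z - 1) / z\<close>.\<close>

lemma csc_minus_inverse_extension:
  obtains r and h :: "complex \<Rightarrow> complex"
  where "0 < r" "h holomorphic_on ball 0 r"
    "\<And>z. z \<in> ball 0 r \<Longrightarrow> z \<noteq> 0 \<Longrightarrow> sin z \<noteq> 0 \<and> h z = 1 / sin z - 1 / z"
proof -
  define S where "S = (\<lambda>z::complex. if z = 0 then deriv sin 0 else (sin z - sin 0) / (z - 0))"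
  have S: "S holomorphic_on UNIV"
    unfolding S_def by (rule pole_lemma_open) (auto intro!: holomorphic_intros)
  have S0: "S 0 = 1"
    unfolding S_def using DERIV_imp_deriv[OF DERIV_sin[of "0::complex"]] by simp
  have "isCont S 0"
    using holomorphic_on_imp_continuous_on[OF S] by (simp add: continuous_on_eq_continuous_at)
  then have "(S \<longlongrightarrow> 1) (nhds 0)"
    using S0 tendsto_at_iff_tendsto_nhds[of S 0] by (simp add: isCont_def)
  then have "\<forall>\<^sub>F z in nhds 0. S z \<noteq> 0"
    by (rule tendsto_imp_eventually_ne) simp
  then obtain r where r: "r > 0" "\<And>z. dist z 0 < r \<Longrightarrow> S z \<noteq> 0"
    unfolding eventually_nhds_metric by blast
  define T where "T = (\<lambda>z. 1 / S z)"
  have T: "T holomorphic_on ball 0 r"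
    unfolding T_def using r(2) by (intro holomorphic_intros holomorphic_on_subset[OF S]) (auto simp: dist_commute)
  define h where "h = (\<lambda>z. if z = 0 then deriv T 0 else (T z - T 0) / (z - 0))"
  have h: "h holomorphic_on ball 0 r"
    unfolding h_def by (rule pole_lemma_open) (use T in auto)
  show thesis
  proof (rule that[of r h])
    fix z :: complex assume z: "z \<in> ball 0 r" "z \<noteq> 0"
    then have "sin z \<noteq> 0"
      using r(2)[of z] by (auto simp: S_def dist_commute)
    then show "sin z \<noteq> 0 \<and> h z = 1 / sin z - 1 / z"
      using z S0 by (simp add: h_def T_def) (simp add: S_def field_simps)
  qed (use r h in auto)
qed

text \<open>
  Any solution of this recurrence has the form \<open>sin z ^ (n + 1) * (-1) ^ n / n! * (d/dz) ^ n u\<close>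
  where \<open>u = c 0 / sin\<close>. For \<open>u = 1 / z\<close> it is \<open>(sin z / z) ^ (n + 1)\<close>, and the remainder
  \<open>csc z - 1 / z\<close> is holomorphic at \<open>0\<close>, so Cauchy's inequality bounds its contribution.
\<close>

lemma csc_recurrence_approx:
  fixes c :: "nat \<Rightarrow> complex \<Rightarrow> complex"
  assumes c0: "\<And>z. c 0 z = 1"
    and diff: "\<And>n z. c n field_differentiable (at z)"
    and rec: "\<And>n z. c (Suc n) z = cos z * c n z - sin z * deriv (c n) z / of_nat (Suc n)"
  obtains r M where "0 < r"
    "\<And>n z. norm z < r \<Longrightarrow> z \<noteq> 0 \<Longrightarrow>
       norm (c n z - (sin z / z) ^ Suc n) \<le> M * norm (sin z) ^ Suc n / r ^ n"
proof -
  obtain R h where R: "0 < R" and h: "h holomorphic_on ball 0 R"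
    and hz: "\<And>z. z \<in> ball 0 R \<Longrightarrow> z \<noteq> 0 \<Longrightarrow> sin z \<noteq> 0 \<and> h z = 1 / sin z - 1 / z"
    by (rule csc_minus_inverse_extension) blast
  let ?B = "ball 0 R :: complex set"
  have eq: "c n z = (sin z / z) ^ Suc n + (-1) ^ n / fact n * sin z ^ Suc n * (deriv ^^ n) h z"
    if "z \<in> ?B" "z \<noteq> 0" for n z
    using that
  proof (induction n arbitrary: z)
    case 0
    then have "sin z \<noteq> 0" "h z = 1 / sin z - 1 / z" using hz[of z] by auto
    then show ?case by (simp add: c0 right_diff_distrib)
  next
    case (Suc n)
    define H where "H = (deriv ^^ n) h"
    define a where "a = ((-1) ^ n / fact n :: complex)"
    have H: "H holomorphic_on ?B"
      unfolding H_def using h by (rule holomorphic_higher_deriv) simp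
    then have dH: "(H has_field_derivative deriv H z) (at z)"
      using Suc.prems by (intro holomorphic_derivI[of _ ?B]) auto
    have "((\<lambda>z. (sin z / z) ^ Suc n + a * sin z ^ Suc n * H z) has_field_derivative
        of_nat (Suc n) * (sin z / z) ^ n * ((cos z * z - sin z) / z ^ 2)
        + (a * (of_nat (Suc n) * sin z ^ n * cos z) * H z + a * sin z ^ Suc n * deriv H z)) (at z)"
      using Suc.prems dH by (auto intro!: derivative_eq_intros simp: power2_eq_square simp del: power_Suc of_nat_Suc)
    \<comment> \<open>The formula for \<open>c n\<close> is known only off 0, so the derivative is
      transferred on the punctured disc.\<close>
    then have "(c n has_field_derivative
        of_nat (Suc n) * (sin z / z) ^ n * ((cos z * z - sin z) / z ^ 2)
        + (a * (of_nat (Suc n) * sin z ^ n * cos z) * H z + a * sin z ^ Suc n * deriv H z)) (at z)"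
    proof (rule has_field_derivative_transform_within_open)
      show "open (?B - {0})" by (simp add: open_delete)
      show "z \<in> ?B - {0}" using Suc.prems by simp
      show "\<And>x. x \<in> ?B - {0} \<Longrightarrow> (sin x / x) ^ Suc n + a * sin x ^ Suc n * H x = c n x"
        using Suc.IH by (simp add: a_def H_def)
    qed
    then have d: "deriv (c n) z = of_nat (Suc n) * (sin z / z) ^ n * ((cos z * z - sin z) / z ^ 2)
        + (a * (of_nat (Suc n) * sin z ^ n * cos z) * H z + a * sin z ^ Suc n * deriv H z)"
      by (rule DERIV_imp_deriv)
    have IH: "c n z = (sin z / z) ^ Suc n + a * sin z ^ Suc n * H z"
      using Suc by (simp add: a_def H_def)
    define N where "N = (of_nat (Suc n) :: complex)"
    have N: "N \<noteq> 0" unfolding N_def by (rule of_nat_neq_0)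
    define s co q where "s = sin z" and "co = cos z" and "q = (sin z / z) ^ n"
    define t where "t = sin z ^ n"
    have a': "(-1) ^ Suc n / fact (Suc n) = - a / N"
      by (simp add: a_def N_def field_simps)
    have "c (Suc n) z = co * (q * (s / z) + a * (t * s) * H z)
        - s * (N * q * ((co * z - s) / z ^ 2) + (a * (N * t * co) * H z + a * (t * s) * deriv H z)) / N"
      unfolding rec d IH N_def s_def co_def q_def t_def by (simp add: mult.commute)
    \<comment> \<open>All terms with \<open>cos z\<close> cancel, leaving the next power of
      \<open>sin z / z\<close> and the next derivative of \<open>h\<close>.\<close>
    also have "\<dots> = q * (s / z) * (s / z) + (- a / N) * (t * s * s) * deriv H z"
      using N Suc.prems by (simp add: field_simps power2_eq_square)
    also have "\<dots> = (sin z / z) ^ Suc (Suc n) + (-1) ^ Suc n / fact (Suc n) * sin z ^ Suc (Suc n) * (deriv ^^ Suc n) h z"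
      unfolding a' by (simp add: H_def s_def q_def t_def mult.commute mult.left_commute)
    finally show ?case .
  qed
  \<comment> \<open>Closed discs of radius \<open>r\<close> about points of norm below
    \<open>r\<close> lie in \<open>cball 0 (2 * r)\<close>, a compact part of the domain of
    \<open>h\<close>, so one bound \<open>M\<close> serves all Cauchy estimates.\<close>
  define r where "r = R / 3"
  have r: "0 < r" "r < R" "2 * r < R" using R by (auto simp: r_def)
  have "compact (h ` cball 0 (2 * r))"
    using r by (intro compact_continuous_image holomorphic_on_imp_continuous_on holomorphic_on_subset[OF h]) auto
  then obtain M where M: "\<And>z. z \<in> cball 0 (2 * r) \<Longrightarrow> norm (h z) \<le> M"
    by (meson bounded_iff compact_imp_bounded image_eqI)
  have bound: "norm ((deriv ^^ n) h z) \<le> fact n * M / r ^ n" if "norm z < r" for n z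
  proof (rule Cauchy_inequality)
    have sub: "cball z r \<subseteq> cball 0 (2 * r)"
      using that by (intro cball_subset_cball_iff[THEN iffD2]) auto
    then show "continuous_on (cball z r) h"
      using r by (intro holomorphic_on_imp_continuous_on holomorphic_on_subset[OF h]) auto
    show "h holomorphic_on ball z r"
      using r sub ball_subset_cball by (intro holomorphic_on_subset[OF h]) fastforce
    show "norm (h x) \<le> M" if "norm (z - x) = r" for x
      using that sub by (intro M) (auto simp: dist_norm)
  qed (use r in auto)
  show thesis
  proof (rule that[OF r(1), of M])
    fix n z assume z: "norm z < r" "z \<noteq> (0::complex)"
    have "norm (c n z - (sin z / z) ^ Suc n) = norm (sin z) ^ Suc n / fact n * norm ((deriv ^^ n) h z)"
      using z r by (subst eq) (auto simp: norm_mult norm_divide norm_power simp del: power_Suc)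
    also have "\<dots> \<le> norm (sin z) ^ Suc n / fact n * (fact n * M / r ^ n)"
      using bound[OF z(1)] by (intro mult_left_mono) auto
    finally show "norm (c n z - (sin z / z) ^ Suc n) \<le> M * norm (sin z) ^ Suc n / r ^ n"
      by (simp add: mult.commute)
  qed
qed

text \<open>As \<open>ln (sin x / x)\<close> behaves like \<open>- x^2 / 6\<close> near 0, the
  logarithm of the power tends to \<open>- a / 6\<close>. The case \<open>x n = 0\<close> is
  excluded because the quotient would be 0 by convention.\<close>

lemma tendsto_sin_quotient_power:
  fixes x :: "nat \<Rightarrow> real"
  assumes x: "x \<longlonglongrightarrow> 0" and x2: "(\<lambda>n. real n * x n ^ 2) \<longlonglongrightarrow> a"
    and nz: "\<forall>\<^sub>F n in sequentially. x n \<noteq> 0"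
  shows "(\<lambda>n. (sin (x n) / x n) ^ Suc n) \<longlonglongrightarrow> exp (- a / 6)"
proof -
  have l: "((\<lambda>x::real. ln (sin x / x) / x ^ 2) \<longlongrightarrow> - 1 / 6) (at 0)"
    by real_asymp
  have x_at: "filterlim x (at 0) sequentially"
    using x nz by (simp add: filterlim_at)
  have pos: "\<forall>\<^sub>F x::real in at 0. 0 < sin x / x"
    by real_asymp
  have "(\<lambda>n. real (Suc n) * x n ^ 2) \<longlonglongrightarrow> a"
    using tendsto_add[OF x2 tendsto_power[OF x, of 2]] by (simp add: algebra_simps)
  then have "(\<lambda>n. real (Suc n) * x n ^ 2 * (ln (sin (x n) / x n) / x n ^ 2)) \<longlonglongrightarrow> a * (- 1 / 6)"
    by (rule tendsto_mult[OF _ filterlim_compose[OF l x_at]])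
  then have "(\<lambda>n. exp (real (Suc n) * x n ^ 2 * (ln (sin (x n) / x n) / x n ^ 2))) \<longlonglongrightarrow> exp (a * (- 1 / 6))"
    by (rule tendsto_exp)
  moreover have "\<forall>\<^sub>F n in sequentially. exp (real (Suc n) * x n ^ 2 * (ln (sin (x n) / x n) / x n ^ 2)) =
      (sin (x n) / x n) ^ Suc n"
    using nz filterlim_iff[THEN iffD1, OF x_at, rule_format, OF pos]
  proof eventually_elim
    case (elim n)
    then have "exp (real (Suc n) * x n ^ 2 * (ln (sin (x n) / x n) / x n ^ 2)) = exp (real (Suc n) * ln (sin (x n) / x n))"
      by simp
    also have "\<dots> = (sin (x n) / x n) ^ Suc n"
      using elim by (simp only: exp_of_nat_mult exp_ln)
    finally show ?case .
  qed
  ultimately show ?thesis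
    by (simp add: filterlim_cong)
qed

lemma csc_recurrence_tendsto:
  fixes c :: "nat \<Rightarrow> complex \<Rightarrow> complex" and x :: "nat \<Rightarrow> real"
  assumes c0: "\<And>z. c 0 z = 1"
    and diff: "\<And>n z. c n field_differentiable (at z)"
    and rec: "\<And>n z. c (Suc n) z = cos z * c n z - sin z * deriv (c n) z / of_nat (Suc n)"
    and x: "x \<longlonglongrightarrow> 0" and x2: "(\<lambda>n. real n * x n ^ 2) \<longlonglongrightarrow> a"
    and nz: "\<forall>\<^sub>F n in sequentially. x n \<noteq> 0"
  shows "(\<lambda>n. c n (of_real (x n))) \<longlonglongrightarrow> of_real (exp (- a / 6))"
proof -
  obtain r M where r: "0 < r" and bound: "\<And>n z. norm z < r \<Longrightarrow> z \<noteq> 0 \<Longrightarrow>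
       norm (c n z - (sin z / z) ^ Suc n) \<le> M * norm (sin z) ^ Suc n / r ^ n"
    using csc_recurrence_approx[OF c0 diff rec] by blast
  \<comment> \<open>Halving the radius turns the error bound into a multiple of
    \<open>(1 / 2) ^ Suc n\<close>.\<close>
  have small: "\<forall>\<^sub>F n in sequentially. \<bar>x n\<bar> < r / 2"
    using tendstoD[OF x, of "r / 2"] r by (simp add: dist_norm)
  have "(\<lambda>n. c n (of_real (x n)) - of_real ((sin (x n) / x n) ^ Suc n)) \<longlonglongrightarrow> 0"
  proof (rule Lim_null_comparison)
    show "\<forall>\<^sub>F n in sequentially. norm (c n (of_real (x n)) - of_real ((sin (x n) / x n) ^ Suc n)) \<le> \<bar>M\<bar> * r * (1 / 2) ^ Suc n"
      using small nz
    proof eventually_elim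
      case (elim n)
      let ?z = "of_real (x n) :: complex"
      have sin: "sin ?z = of_real (sin (x n))" by (simp add: sin_of_real)
      have "norm (c n ?z - (sin ?z / ?z) ^ Suc n) \<le> M * norm (sin ?z) ^ Suc n / r ^ n"
        by (rule bound) (use elim r in auto)
      also have "\<dots> \<le> \<bar>M\<bar> * (r / 2) ^ Suc n / r ^ n"
      proof (intro divide_right_mono mult_mono power_mono)
        show "norm (sin ?z) \<le> r / 2"
          using elim abs_sin_x_le_abs_x[of "x n"] by (simp add: sin)
      qed (use r in auto)
      also have "\<dots> = \<bar>M\<bar> * r * (1 / 2) ^ Suc n"
        using r by (simp add: power_divide)
      finally show ?case by (simp add: sin)
    qed
    have "(\<lambda>n. (1 / 2 :: real) ^ Suc n) \<longlonglongrightarrow> 0"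
      by (rule LIMSEQ_Suc) (simp add: LIMSEQ_power_zero)
    then show "(\<lambda>n. \<bar>M\<bar> * r * (1 / 2) ^ Suc n) \<longlonglongrightarrow> 0"
      using tendsto_mult_right_zero by blast
  qed
  moreover have "(\<lambda>n. complex_of_real ((sin (x n) / x n) ^ Suc n)) \<longlonglongrightarrow> of_real (exp (- a / 6))"
    by (intro tendsto_of_real tendsto_sin_quotient_power x x2 nz)
  ultimately show ?thesis
    using tendsto_add by fastforce
qed

section \<open>Moments and characteristic functions\<close>

text \<open>Centring at half the size makes the coefficients symmetric, and as the centre moves by
  1/2 the outcomes become steps of -1/2 and +1/2. Mean, variance and characteristic function all
  start from this form.\<close>

lemma avgB_centered_Suc:
  fixes f :: "real \<Rightarrow> 'a::real_normed_field"
  shows "avgB (Suc n) (\<lambda>y. f (real y - real (Suc n) / 2)) = avgB n (\<lambda>y. let z = real y - real n / 2 in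
     (1 / 2 + of_real (z / real (Suc n))) * f (z - 1 / 2) + (1 / 2 - of_real (z / real (Suc n))) * f (z + 1 / 2))"
proof -
  have "of_real ((real y - real n / 2) / real (Suc n)) = (of_nat y - of_nat n / 2) / (of_nat (Suc n) :: 'a)" for y
    by simp
  moreover have "real y - real (Suc n) / 2 = real y - real n / 2 - 1 / 2"
    "real (Suc y) - real (Suc n) / 2 = real y - real n / 2 + 1 / 2" for y
    by (simp_all add: field_simps)
  ultimately show ?thesis
    unfolding avgB_Suc Let_def by presburger
qed

lemma avgB_centered_mean: "avgB n (\<lambda>y. real y - real n / 2) = 0"
proof (induction n)
  case (Suc n)
  have alg: "(1 / 2 + z / d) * (z - 1 / 2) + (1 / 2 - z / d) * (z + 1 / 2) = (1 - 1 / d) * z" for z d :: real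
    by (simp add: algebra_simps)
  have "avgB (Suc n) (\<lambda>y. real y - real (Suc n) / 2) = avgB n (\<lambda>y. (1 - 1 / real (Suc n)) * (real y - real n / 2))"
    unfolding avgB_centered_Suc[where f = "\<lambda>z. z"] Let_def of_real_eq_id id_def alg ..
  then show ?case
    unfolding avgB_cmult Suc by simp
qed (simp add: avgB_0)

definition varB :: "nat \<Rightarrow> real" where
  "varB n = avgB n (\<lambda>y. (real y - real n / 2)\<^sup>2)"

lemma varB_Suc: "varB (Suc n) = (1 - 2 / real (Suc n)) * varB n + 1 / 4"
proof -
  have alg: "(1 / 2 + z / d) * (z - 1 / 2)\<^sup>2 + (1 / 2 - z / d) * (z + 1 / 2)\<^sup>2 = (1 - 2 / d) * z\<^sup>2 + 1 / 4"
    for z d :: real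
    by (simp add: power2_eq_square algebra_simps)
  have "varB (Suc n) = avgB n (\<lambda>y. (1 - 2 / real (Suc n)) * (real y - real n / 2)\<^sup>2 + 1 / 4)"
    unfolding varB_def avgB_centered_Suc[where f = "\<lambda>z. z\<^sup>2"] Let_def of_real_eq_id id_def alg ..
  then show ?thesis
    unfolding avgB_add avgB_cmult avgB_const varB_def .
qed

text \<open>The factor \<open>1 - 2 / real (Suc n)\<close> vanishes at \<open>n = 1\<close>, so the
  recursion forgets its start; the values 0 and 1/4 at sizes 0 and 1 do not fit the formula.\<close>

lemma varB_eq: "2 \<le> n \<Longrightarrow> varB n = (real n + 1) / 12"
proof (induction n rule: dec_induct)
  case base
  have "varB 0 = 0" by (simp add: varB_def avgB_0)
  then show ?case by (simp add: varB_Suc numeral_2_eq_2)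
next
  case (step n)
  then have eq: "varB n = (real n + 1) / 12" by simp
  show ?case unfolding varB_Suc eq by (simp add: field_simps)
qed

lemma varB_bounds: "0 \<le> varB n" "varB n \<le> real n"
proof -
  have "varB 0 = 0" by (simp add: varB_def avgB_0)
  moreover from this have "varB 1 = 1 / 4" by (simp add: varB_Suc)
  moreover have "n = 0 \<or> n = 1 \<or> 2 \<le> n" by auto
  ultimately show "0 \<le> varB n" "varB n \<le> real n"
    using varB_eq[of n] by auto
qed

text \<open>The characteristic function at \<open>2 * z\<close>, so that steps of 1/2 become factors
  \<open>exp (\<i> * z)\<close> and \<open>exp (- \<i> * z)\<close>; complex arguments give access
  to Cauchy's inequality.\<close>

definition cfB :: "nat \<Rightarrow> complex \<Rightarrow> complex" where
  "cfB n z = avgB n (\<lambda>y. exp (2 * \<i> * z * of_real (real y - real n / 2)))"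

lemma cfB_has_derivative:
  "(cfB n has_field_derivative
     avgB n (\<lambda>y. 2 * \<i> * of_real (real y - real n / 2) * exp (2 * \<i> * z * of_real (real y - real n / 2)))) (at z)"
  unfolding cfB_def[abs_def] avgB_def sumB_def
  by (rule derivative_eq_intros refl | simp add: mult_ac)+

text \<open>Euler's formula produces \<open>cos z\<close> and \<open>sin z\<close>; the part of the
  coefficients linear in the centred value becomes a derivative, since differentiating the
  exponential brings down that value times \<open>2 * \<i>\<close>.\<close>

lemma cfB_Suc: "cfB (Suc n) z = cos z * cfB n z - sin z * deriv (cfB n) z / of_nat (Suc n)"
proof -
  have alg: "(1 / 2 + of_real (x / real (Suc n))) * exp (2 * \<i> * z * of_real (x - 1 / 2)) +
      (1 / 2 - of_real (x / real (Suc n))) * exp (2 * \<i> * z * of_real (x + 1 / 2)) =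
      cos z * exp (2 * \<i> * z * of_real x)
        + (- sin z / of_nat (Suc n)) * (2 * \<i> * of_real x * exp (2 * \<i> * z * of_real x))" for x
  proof -
    define e where "e = exp (2 * \<i> * z * of_real x)"
    define w where "w = complex_of_real x / of_nat (Suc n)"
    have "exp (2 * \<i> * z * of_real (x - 1 / 2)) = e * exp (- (\<i> * z))"
      "exp (2 * \<i> * z * of_real (x + 1 / 2)) = e * exp (\<i> * z)"
      by (simp_all add: e_def algebra_simps flip: exp_add)
    moreover have "exp (\<i> * z) = cos z + \<i> * sin z" "exp (- (\<i> * z)) = cos z - \<i> * sin z"
      using exp_Euler[of z] exp_Euler[of "- z"] by simp_all
    moreover have "of_real (x / real (Suc n)) = w" by (simp add: w_def)
    moreover have "(1 / 2 + w) * (e * (cos z - \<i> * sin z)) + (1 / 2 - w) * (e * (cos z + \<i> * sin z)) =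
        cos z * e - sin z * w * (2 * \<i> * e)"
      by (simp add: algebra_simps)
    ultimately show ?thesis
      by (simp add: e_def[symmetric]) (simp add: w_def)
  qed
  have "cfB (Suc n) z = avgB n (\<lambda>y. cos z * exp (2 * \<i> * z * of_real (real y - real n / 2))
        + (- sin z / of_nat (Suc n)) * (2 * \<i> * of_real (real y - real n / 2) * exp (2 * \<i> * z * of_real (real y - real n / 2))))"
    unfolding cfB_def avgB_centered_Suc[where f = "\<lambda>x. exp (2 * \<i> * z * of_real x)"] Let_def alg ..
  then show ?thesis
    unfolding avgB_add avgB_cmult DERIV_imp_deriv[OF cfB_has_derivative]
    by (simp add: cfB_def)
qed

lemma cfB_tendsto:
  fixes x :: "nat \<Rightarrow> real"
  assumes "x \<longlonglongrightarrow> 0" "(\<lambda>n. real n * x n ^ 2) \<longlonglongrightarrow> a" "\<forall>\<^sub>F n in sequentially. x n \<noteq> 0"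
  shows "(\<lambda>n. cfB n (of_real (x n))) \<longlonglongrightarrow> of_real (exp (- a / 6))"
proof (rule csc_recurrence_tendsto[OF _ _ cfB_Suc assms])
  show "cfB 0 z = 1" for z by (simp add: cfB_def avgB_0)
  show "cfB n field_differentiable at z" for n z
    using cfB_has_derivative by (auto simp: field_differentiable_def)
qed

text \<open>The coefficients are at most \<open>1 / 2 ^ k\<close> in modulus. The quadratic factor
  leaves room for terms that grow like \<open>k\<close> in the mean and \<open>k^2\<close> in the
  variance.\<close>

lemma summable_inv_exp_coeff: "summable (\<lambda>k. \<bar>inv_exp_coeff k\<bar> * (1 + real k)\<^sup>2)"
proof (rule summable_comparison_test')
  show "summable (\<lambda>k. (1 + real k)\<^sup>2 / 2 ^ k)"
  proof (rule summable_comparison_test_bigo)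
    show "(\<lambda>k. (1 + real k)\<^sup>2 / 2 ^ k) \<in> O(\<lambda>k. inverse (real k ^ 2))" by real_asymp
    show "summable (\<lambda>k. norm (inverse (real k ^ 2)))"
      using inverse_power_summable[of 2, where 'a = real] by simp
  qed
  show "norm (\<bar>inv_exp_coeff k\<bar> * (1 + real k)\<^sup>2) \<le> (1 + real k)\<^sup>2 / 2 ^ k" for k
    using fact_ge_1[of k, where 'a = real]
    by (simp add: inv_exp_coeff_def abs_mult power_abs field_simps mult_left_le)
qed

lemma inv_exp_coeff_sums: "inv_exp_coeff sums exp (- 1 / 2)"
proof -
  have "(-1 / 2 :: real) ^ k /\<^sub>R fact k = inv_exp_coeff k" for k
    using power_divide[of "-1::real" 2 k] by (simp add: inv_exp_coeff_def field_simps)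
  then show ?thesis
    using exp_converges[of "-1 / 2 :: real"] by simp
qed

lemma inv_exp_sum_tendsto: "inv_exp_sum \<longlonglongrightarrow> exp (- 1 / 2)"
  using inv_exp_coeff_sums unfolding sums_def_le inv_exp_sum_def[abs_def] .

text \<open>Positivity of this alternating sum is read off from the nonzero number of
  derangements.\<close>

lemma inv_exp_sum_pos: "0 < inv_exp_sum n"
proof -
  have "0 < card (derangementsB n)"
    using finite_derangementsB derangementsB_nonempty by (simp add: card_gt_0_iff)
  then have "0 < 2 ^ n * fact n * inv_exp_sum n"
    by (simp only: of_nat_0_less_iff flip: card_derangementsB)
  then show ?thesis by (rule zero_less_mult_pos) simp
qed

text \<open>
  By \<open>expectation_rand_derangementB\<close>, the law of the excedance number on derangements is a
  mixture, with signed but absolutely summable weights, of those on all signed permutations of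
  sizes \<open>n, n - 1, \<dots>\<close>. Limits can therefore be taken term by term.
\<close>

lemma signed_mixture_tendsto:
  fixes a :: "nat \<Rightarrow> nat \<Rightarrow> 'a::{real_normed_field, banach}"
  assumes lim: "\<And>k. (\<lambda>n. a k n) \<longlonglongrightarrow> b"
    and bound: "\<And>k n. k \<le> n \<Longrightarrow> norm (a k n) \<le> (1 + real k)\<^sup>2"
  shows "(\<lambda>n. (\<Sum>k\<le>n. of_real (inv_exp_coeff k) * a k n) / of_real (inv_exp_sum n)) \<longlonglongrightarrow> b"
proof -
  \<comment> \<open>Cut off at \<open>k = n\<close>, the finite sums become series in
    \<open>k\<close>, to which Tannery's theorem applies.\<close>
  define a' where "a' k n = (if k \<le> n then of_real (inv_exp_coeff k) * a k n else 0)" for k n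
  have "(\<lambda>n. suminf (\<lambda>k. a' k n)) \<longlonglongrightarrow> suminf (\<lambda>k. of_real (inv_exp_coeff k) * b)"
  proof (rule tannerys_theorem[THEN conjunct2, THEN conjunct2])
    show "(\<lambda>n. a' k n) \<longlonglongrightarrow> of_real (inv_exp_coeff k) * b" for k
    proof (rule Lim_transform_eventually)
      show "(\<lambda>n. of_real (inv_exp_coeff k) * a k n) \<longlonglongrightarrow> of_real (inv_exp_coeff k) * b"
        by (intro tendsto_intros lim)
      show "\<forall>\<^sub>F n in sequentially. of_real (inv_exp_coeff k) * a k n = a' k n"
        using eventually_ge_at_top[of k] by eventually_elim (simp add: a'_def)
    qed
    show "\<forall>\<^sub>F (k, n) in at_top \<times>\<^sub>F sequentially. norm (a' k n) \<le> \<bar>inv_exp_coeff k\<bar> * (1 + real k)\<^sup>2"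
      by (intro always_eventually)
        (auto simp: a'_def norm_mult intro!: mult_left_mono bound)
  qed (use summable_inv_exp_coeff in auto)
  moreover have "suminf (\<lambda>k. a' k n) = (\<Sum>k\<le>n. of_real (inv_exp_coeff k) * a k n)" for n
    by (subst suminf_finite[of "{..n}"]) (auto simp: a'_def)
  moreover have "suminf (\<lambda>k. of_real (inv_exp_coeff k) * b) = of_real (exp (- 1 / 2)) * b"
    using sums_mult2[OF sums_of_real[OF inv_exp_coeff_sums], of b] by (rule sums_unique[symmetric])
  ultimately have "(\<lambda>n. \<Sum>k\<le>n. of_real (inv_exp_coeff k) * a k n) \<longlonglongrightarrow> of_real (exp (- 1 / 2)) * b"
    by simp
  then have "(\<lambda>n. (\<Sum>k\<le>n. of_real (inv_exp_coeff k) * a k n) / of_real (inv_exp_sum n))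
      \<longlonglongrightarrow> of_real (exp (- 1 / 2)) * b / of_real (exp (- 1 / 2))"
    by (intro tendsto_divide tendsto_of_real inv_exp_sum_tendsto) auto
  then show ?thesis by simp
qed

text \<open>By \<open>expectation_rand_derangementB\<close> this is the expectation of
  \<open>g\<close> at the excedance number of a uniform derangement, in a form whose linearity needs
  no integration.\<close>

definition mixB :: "nat \<Rightarrow> (nat \<Rightarrow> 'a::real_normed_field) \<Rightarrow> 'a" where
  "mixB n g = (\<Sum>k\<le>n. of_real (inv_exp_coeff k) * avgB (n - k) g) / of_real (inv_exp_sum n)"

lemma mixB_add: "mixB n (\<lambda>y. g y + h y) = mixB n g + mixB n h"
  by (simp add: mixB_def avgB_add distrib_left sum.distrib add_divide_distrib)

lemma mixB_cmult: "mixB n (\<lambda>y. c * g y) = c * mixB n g"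
  by (simp add: mixB_def avgB_cmult sum_distrib_left mult.left_commute)

lemma mixB_const: "mixB n (\<lambda>_. c) = c"
proof -
  have "of_real (inv_exp_sum n) = (\<Sum>k\<le>n. of_real (inv_exp_coeff k) :: 'a)"
    by (simp add: inv_exp_sum_def)
  moreover have "of_real (inv_exp_sum n) \<noteq> (0 :: 'a)"
    using inv_exp_sum_pos[of n] by simp
  ultimately show ?thesis
    by (simp add: mixB_def avgB_const flip: sum_distrib_right)
qed

section \<open>Asymptotic mean and variance on derangements\<close>

definition meanD :: "nat \<Rightarrow> real" where
  "meanD n = mixB n real"

definition varD :: "nat \<Rightarrow> real" where
  "varD n = mixB n (\<lambda>y. (real y - meanD n)\<^sup>2)"

lemma avgB_shift: "avgB (n - k) (\<lambda>y. real y - real n / 2) = - real k / 2" if "k \<le> n"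
proof -
  have "(\<lambda>y. real y - real n / 2) = (\<lambda>y. (real y - real (n - k) / 2) + (- real k / 2))"
    using that by (auto simp: field_simps)
  then show ?thesis
    by (simp only: avgB_add avgB_centered_mean avgB_const)
qed

text \<open>Variance plus squared bias: size \<open>n - k\<close> has mean
  \<open>(n - k) / 2\<close>, which lies \<open>k / 2\<close> below \<open>n / 2\<close>.\<close>

lemma avgB_shift_square:
  "avgB (n - k) (\<lambda>y. (real y - real n / 2)\<^sup>2) = varB (n - k) + (real k)\<^sup>2 / 4" if "k \<le> n"
proof -
  have "(\<lambda>y. (real y - real n / 2)\<^sup>2) =
      (\<lambda>y. (real y - real (n - k) / 2)\<^sup>2 + (- real k * (real y - real (n - k) / 2) + (real k)\<^sup>2 / 4))"
    using that by (auto simp: field_simps power2_eq_square)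
  then show ?thesis
    by (simp only: avgB_add avgB_cmult avgB_centered_mean avgB_const varB_def[symmetric])
qed

text \<open>The component with index \<open>k\<close> is off by \<open>- k / 2\<close>, negligible
  against \<open>sqrt n\<close>. This accuracy permits centring at \<open>n / 2\<close> in the
  variance and in the phase of the characteristic function.\<close>

lemma meanD_deviation: "(\<lambda>n. (meanD n - real n / 2) / sqrt (real n)) \<longlonglongrightarrow> 0"
proof -
  define a where "a k n = 1 / sqrt (real n) * (- real k / 2)" for k n
  have "(\<lambda>n. (\<Sum>k\<le>n. of_real (inv_exp_coeff k) * a k n) / of_real (inv_exp_sum n)) \<longlonglongrightarrow> 0"
  proof (rule signed_mixture_tendsto)
    show "(\<lambda>n. a k n) \<longlonglongrightarrow> 0" for k unfolding a_def by real_asymp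
    fix k n :: nat
    have "\<bar>1 / sqrt (real n)\<bar> \<le> 1" by (cases "n = 0") auto
    then have "norm (a k n) \<le> 1 * (real k / 2)"
      unfolding a_def real_norm_def abs_mult by (intro mult_mono) auto
    also have "\<dots> \<le> (1 + real k)\<^sup>2" by (simp add: power2_eq_square algebra_simps)
    finally show "norm (a k n) \<le> (1 + real k)\<^sup>2" .
  qed
  moreover have "(\<Sum>k\<le>n. of_real (inv_exp_coeff k) * a k n) / of_real (inv_exp_sum n) =
      (meanD n - real n / 2) / sqrt (real n)" for n
  proof -
    have "(\<Sum>k\<le>n. of_real (inv_exp_coeff k) * a k n) / of_real (inv_exp_sum n) =
        mixB n (\<lambda>y. 1 / sqrt (real n) * (real y - real n / 2))"
      unfolding mixB_def a_def avgB_cmult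
      by (intro arg_cong2[where f = "(/)"] sum.cong refl) (simp add: avgB_shift)
    moreover have "mixB n (\<lambda>y. real y - real n / 2) = meanD n - real n / 2"
      using mixB_add[of n real "\<lambda>_. - (real n / 2)"] by (simp add: mixB_const meanD_def)
    ultimately show ?thesis
      unfolding mixB_cmult by simp
  qed
  ultimately show ?thesis by simp
qed

text \<open>The second moment about \<open>n / 2\<close> is a mixture of terms close to
  \<open>n / 12\<close>; passing to the true mean subtracts the squared deviation, which is
  \<open>o(n)\<close> by \<open>meanD_deviation\<close>.\<close>

lemma varD_asymptotics: "(\<lambda>n. varD n / real n) \<longlonglongrightarrow> 1 / 12"
proof -
  define a where "a k n = 1 / real n * (varB (n - k) + (real k)\<^sup>2 / 4)" for k n
  have "(\<lambda>n. (\<Sum>k\<le>n. of_real (inv_exp_coeff k) * a k n) / of_real (inv_exp_sum n)) \<longlonglongrightarrow> 1 / 12"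
  proof (rule signed_mixture_tendsto)
    fix k
    have "(\<lambda>n. 1 / real n * ((real n - real k + 1) / 12 + (real k)\<^sup>2 / 4)) \<longlonglongrightarrow> 1 / 12"
      by real_asymp
    then show "(\<lambda>n. a k n) \<longlonglongrightarrow> 1 / 12"
    proof (rule Lim_transform_eventually)
      show "\<forall>\<^sub>F n in sequentially. 1 / real n * ((real n - real k + 1) / 12 + (real k)\<^sup>2 / 4) = a k n"
        using eventually_ge_at_top[of "k + 2"]
        by eventually_elim (simp add: a_def varB_eq)
    qed
    fix n assume "k \<le> n"
    show "norm (a k n) \<le> (1 + real k)\<^sup>2"
    proof (cases "n = 0")
      case False
      have "\<bar>varB (n - k) + (real k)\<^sup>2 / 4\<bar> \<le> real n + (real k)\<^sup>2 / 4"
        using varB_bounds[of "n - k"] \<open>k \<le> n\<close> by auto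
      also have "\<dots> \<le> real n * (1 + real k)\<^sup>2"
      proof -
        have "real n * (1 + real k)\<^sup>2 = real n + 2 * (real n * real k) + real n * (real k)\<^sup>2"
          by (simp add: power2_eq_square algebra_simps)
        moreover have "1 * (real k)\<^sup>2 \<le> real n * (real k)\<^sup>2"
          using False by (intro mult_right_mono) auto
        moreover have "0 \<le> real n * real k" "0 \<le> (real k)\<^sup>2" by simp_all
        ultimately show ?thesis by linarith
      qed
      finally show ?thesis
        using False by (simp add: a_def abs_mult field_simps)
    qed (simp add: a_def)
  qed
  moreover have "(\<Sum>k\<le>n. of_real (inv_exp_coeff k) * a k n) / of_real (inv_exp_sum n) =
      varD n / real n + ((meanD n - real n / 2) / sqrt (real n))\<^sup>2" for n
  proof -
    define m where "m = meanD n - real n / 2"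
    have "mixB n (\<lambda>y. (real y - meanD n)) = 0"
      using mixB_add[of n real "\<lambda>_. - meanD n"] by (simp add: mixB_const meanD_def)
    moreover have "(\<lambda>y. (real y - real n / 2)\<^sup>2) =
        (\<lambda>y. (real y - meanD n)\<^sup>2 + (2 * m * (real y - meanD n) + m\<^sup>2))"
      by (auto simp: m_def power2_eq_square algebra_simps)
    ultimately have "mixB n (\<lambda>y. (real y - real n / 2)\<^sup>2) = varD n + m\<^sup>2"
      by (simp only: mixB_add mixB_cmult mixB_const varD_def[symmetric])
    moreover have "(\<Sum>k\<le>n. of_real (inv_exp_coeff k) * a k n) / of_real (inv_exp_sum n) =
        mixB n (\<lambda>y. 1 / real n * (real y - real n / 2)\<^sup>2)"
      unfolding mixB_def a_def avgB_cmult
      by (intro arg_cong2[where f = "(/)"] sum.cong refl) (simp add: avgB_shift_square)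
    ultimately show ?thesis
      unfolding mixB_cmult by (simp add: m_def power_divide add_divide_distrib)
  qed
  ultimately have "(\<lambda>n. varD n / real n + ((meanD n - real n / 2) / sqrt (real n))\<^sup>2) \<longlonglongrightarrow> 1 / 12"
    by simp
  from tendsto_diff[OF this tendsto_power[OF meanD_deviation, of 2]] show ?thesis by simp
qed

lemma sqrt_varD_asymptotics: "(\<lambda>n. sqrt (varD n) / sqrt (real n)) \<longlonglongrightarrow> sqrt (1 / 12)"
  using tendsto_real_sqrt[OF varD_asymptotics] by (simp add: real_sqrt_divide)

lemma varD_at_top: "filterlim varD at_top sequentially"
proof -
  have "filterlim (\<lambda>n. varD n / real n * real n) at_top sequentially"
    by (rule filterlim_tendsto_pos_mult_at_top[OF varD_asymptotics _ filterlim_real_sequentially]) simp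
  moreover have "\<forall>\<^sub>F n in sequentially. varD n / real n * real n = varD n"
    using eventually_gt_at_top[of 0] by eventually_elim simp
  ultimately show ?thesis
    by (simp add: filterlim_cong)
qed

text \<open>The component has size \<open>n - k\<close> but is centred and scaled by the moments for
  \<open>n\<close>. Once the index is shifted by \<open>k\<close>, the wrong centring is a phase
  \<open>p n\<close> tending to 0, and the rest is \<open>cfB\<close> at \<open>x n\<close>.\<close>

lemma avgB_exp_tendsto:
  assumes t: "t \<noteq> 0"
  shows "(\<lambda>n. avgB (n - k) (\<lambda>y. iexp (t * ((real y - meanD n) / sqrt (varD n)))))
    \<longlonglongrightarrow> of_real (exp (- t\<^sup>2 / 2))"
proof (rule LIMSEQ_offset[of _ k])
  define s where "s n = sqrt (varD (n + k))" for n
  \<comment> \<open>Halved because \<open>cfB\<close> takes the characteristic function at twice its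
    argument.\<close>
  define x where "x n = t / (2 * s n)" for n
  define p where "p n = t * ((real n / 2 - meanD (n + k)) / s n)" for n
  have s_top: "filterlim s at_top sequentially"
    unfolding s_def
    by (intro filterlim_compose[OF sqrt_at_top] filterlim_compose[OF varD_at_top] filterlim_add_const_nat_at_top)
  have inv_s: "(\<lambda>n. c / s n) \<longlonglongrightarrow> 0" for c
    by (rule real_tendsto_divide_at_top[OF tendsto_const s_top])
  have x0: "x \<longlonglongrightarrow> 0"
    using inv_s[of "t / 2"] by (simp add: x_def[abs_def])
  have s_pos: "\<forall>\<^sub>F n in sequentially. 0 < s n"
    using s_top by (simp add: filterlim_at_top_dense)
  have x_nz: "\<forall>\<^sub>F n in sequentially. x n \<noteq> 0"
    using s_pos by eventually_elim (use t in \<open>simp add: x_def\<close>)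
  \<comment> \<open>The variance is about \<open>n / 12\<close>, so the limit is
    \<open>12 * t^2 / 4\<close>; with \<open>a = 3 * t^2\<close>, \<open>cfB_tendsto\<close> gives
    the Gaussian \<open>exp (- t^2 / 2)\<close>.\<close>
  have nx2: "(\<lambda>n. real n * x n ^ 2) \<longlonglongrightarrow> 3 * t\<^sup>2"
  proof -
    have v: "(\<lambda>n. varD (n + k) / real (n + k)) \<longlonglongrightarrow> 1 / 12"
      using LIMSEQ_ignore_initial_segment[OF varD_asymptotics, of k] .
    have w: "(\<lambda>n. real n / real (n + k)) \<longlonglongrightarrow> 1" by real_asymp
    have "(\<lambda>n. t\<^sup>2 / 4 * ((real n / real (n + k)) / (varD (n + k) / real (n + k)))) \<longlonglongrightarrow> t\<^sup>2 / 4 * (1 / (1 / 12))"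
      by (rule tendsto_mult[OF tendsto_const tendsto_divide[OF w v]]) simp
    moreover have "\<forall>\<^sub>F n in sequentially. t\<^sup>2 / 4 * ((real n / real (n + k)) / (varD (n + k) / real (n + k))) = real n * x n ^ 2"
      using s_pos eventually_gt_at_top[of 0]
    proof eventually_elim
      case (elim n)
      then have "x n ^ 2 = t\<^sup>2 / (4 * varD (n + k))" "real (n + k) \<noteq> 0"
        by (simp_all add: x_def s_def power_divide power_mult_distrib)
      then show ?case by (simp add: divide_simps del: of_nat_add)
    qed
    ultimately show ?thesis
      by (simp add: filterlim_cong)
  qed
  have p0: "p \<longlonglongrightarrow> 0"
  proof -
    have "(\<lambda>n. (meanD (n + k) - real (n + k) / 2) / sqrt (real (n + k)) / (s n / sqrt (real (n + k)))) \<longlonglongrightarrow> 0 / sqrt (1 / 12)"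
      unfolding s_def
      using LIMSEQ_ignore_initial_segment[OF meanD_deviation, of k] LIMSEQ_ignore_initial_segment[OF sqrt_varD_asymptotics, of k]
      by (intro tendsto_divide) auto
    \<comment> \<open>Writing \<open>n / 2\<close> as \<open>(n + k) / 2 - k / 2\<close> splits the
      phase into the deviation of the mean and a fixed shift, both small against
      \<open>s n\<close>.\<close>
    then have "(\<lambda>n. t * (- ((meanD (n + k) - real (n + k) / 2) / sqrt (real (n + k)) / (s n / sqrt (real (n + k)))) - (real k / 2) / s n))
        \<longlonglongrightarrow> t * (- (0 / sqrt (1 / 12)) - 0)"
      by (intro tendsto_mult tendsto_const tendsto_diff tendsto_minus inv_s)
    moreover have "\<forall>\<^sub>F n in sequentially.
        t * (- ((meanD (n + k) - real (n + k) / 2) / sqrt (real (n + k)) / (s n / sqrt (real (n + k)))) - (real k / 2) / s n) = p n"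
      using s_pos eventually_gt_at_top[of 0]
      by eventually_elim (simp add: p_def field_simps)
    ultimately show ?thesis
      by (simp add: filterlim_cong)
  qed
  have "avgB (n + k - k) (\<lambda>y. iexp (t * ((real y - meanD (n + k)) / sqrt (varD (n + k))))) =
      iexp (p n) * cfB n (of_real (x n))" for n
  proof -
    have "\<i> * of_real (t * ((real y - meanD (n + k)) / s n)) =
        \<i> * of_real (p n) + 2 * \<i> * of_real (x n) * of_real (real y - real n / 2)" for y
      by (simp add: p_def x_def diff_divide_distrib algebra_simps)
    then show ?thesis
      unfolding s_def[symmetric] cfB_def avgB_cmult[symmetric] by (simp only: exp_add add_diff_cancel_right')
  qed
  moreover have "(\<lambda>n. iexp (p n) * cfB n (of_real (x n))) \<longlonglongrightarrow> iexp 0 * of_real (exp (- (3 * t\<^sup>2) / 6))"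
    by (intro tendsto_mult cfB_tendsto x0 nx2 x_nz tendsto_exp tendsto_of_real p0 tendsto_const)
  ultimately show "(\<lambda>n. avgB (n + k - k) (\<lambda>y. iexp (t * ((real y - meanD (n + k)) / sqrt (varD (n + k))))))
      \<longlonglongrightarrow> of_real (exp (- t\<^sup>2 / 2))"
    by simp
qed

section \<open>The law of \<eta> and its limit\<close>

lemma expectation_\<xi>: "measure_pmf.expectation (rand_derangementB n) (\<xi> n) = meanD n"
  using expectation_rand_derangementB[of n real] by (simp add: \<xi>_def[abs_def] meanD_def mixB_def)

lemma variance_\<xi>: "measure_pmf.variance (rand_derangementB n) (\<xi> n) = varD n"
  using expectation_rand_derangementB[of n "\<lambda>y. (real y - meanD n)\<^sup>2"]
  by (simp add: expectation_\<xi> \<xi>_def varD_def mixB_def)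

lemma char_\<eta>:
  "char (distr (measure_pmf (rand_derangementB n)) borel (\<eta> n)) t =
    mixB n (\<lambda>y. iexp (t * ((real y - meanD n) / sqrt (varD n))))"
proof -
  have "\<eta> n = (\<lambda>\<sigma>. (real (excB n \<sigma>) - meanD n) / sqrt (varD n))"
    unfolding \<eta>_def[abs_def] variance_\<xi> unfolding expectation_\<xi> \<xi>_def ..
  then show ?thesis
    using expectation_rand_derangementB[of n "\<lambda>y. iexp (t * ((real y - meanD n) / sqrt (varD n)))"]
    by (simp add: char_def integral_distr mixB_def)
qed

theorem theorem5p3:
  shows "weak_conv_m (\<lambda>n. distr (measure_pmf (rand_derangementB n)) borel (\<eta> n))
           std_normal_distribution"
proof (rule levy_continuity)
  show "real_distribution (distr (measure_pmf (rand_derangementB n)) borel (\<eta> n))" for n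
    by (rule prob_space.real_distribution_distr[OF measure_pmf.prob_space_axioms]) simp
  show "real_distribution std_normal_distribution"
    by (rule real_dist_normal_dist)
  fix t
  show "(\<lambda>n. char (distr (measure_pmf (rand_derangementB n)) borel (\<eta> n)) t)
      \<longlonglongrightarrow> char std_normal_distribution t"
  \<comment> \<open>At \<open>t = 0\<close> the argument of \<open>cfB\<close> would be 0, which
    \<open>cfB_tendsto\<close> excludes; both characteristic functions equal 1 there.\<close>
  proof (cases "t = 0")
    case True
    then show ?thesis by (simp add: char_\<eta> char_std_normal_distribution mixB_const)
  next
    case False
    have "(\<lambda>n. mixB n (\<lambda>y. iexp (t * ((real y - meanD n) / sqrt (varD n))))) \<longlonglongrightarrow> of_real (exp (- t\<^sup>2 / 2))"
      unfolding mixB_def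
    proof (rule signed_mixture_tendsto[OF avgB_exp_tendsto[OF False]])
      fix k n :: nat
      have "norm (avgB (n - k) (\<lambda>y. iexp (t * ((real y - meanD n) / sqrt (varD n))))) \<le> 1"
        by (rule norm_avgB_le) simp
      also have "1 \<le> (1 + real k)\<^sup>2" by simp
      finally show "norm (avgB (n - k) (\<lambda>y. iexp (t * ((real y - meanD n) / sqrt (varD n))))) \<le> (1 + real k)\<^sup>2" .
    qed
    then show ?thesis by (simp add: char_\<eta> char_std_normal_distribution)
  qed
qed

end
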